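(* Let $(\Omega,\mathcal F,\mathbb P)$ be a standard probability space, $\Lambda$ a finitely generated group acting on it ergodically by probability-measure-preserving transformations, and $S=S^{-1}$ a finite generating set of $\Lambda$. Let $(X,d)$ be Polish and $1\le p<\infty$. For each $s\in S$ let $Y_s$ be a Banach space and $G^s_\omega:X\times X\to Y_s$ ($\omega\in\Omega$) a measurable one-step residual. Let $\xi_0,\xi_1\in L^p(\Omega;X)$ satisfy $d(\xi_0(\omega),\xi_1(\omega))>0$ a.e. and, for every $s\in S$, $$G^s_\omega(\xi_i(\omega),\xi_i(s\omega))=0\quad\text{a.e., }i=0,1.$$ Assume that for every $s\in S$, the functions (with $i,j\in\{0,1\}$) $$q_s(\omega)=\max_{i\neq j}\|G^s_\omega(\xi_i(\omega),\xi_j(s\omega))\|_{Y_s},\qquad r_s(\omega)=\min_{i\ne j}\|G^s_\omega(\xi_i(\omega),\xi_j(s\omega))\|_{Y_s}$$ satisfy $q_s\in L^p(\Omega)$ and $r_s>0$ a.e. For measurable $A\subset\Omega$ let $\Gamma_A=\xi_1$ on $A$ and $\Gamma_A=\xi_0$ on $A^c$. Then the following are equivalent: (i) the action is strongly ergodic; (ii) every branch-pasting sequence $(\Gamma_{A_n})_n$, with $A_n\subset\Omega$ measurable, satisfying $\|\mathbf G(\Gamma_{A_n})\|_{p,S}\to0$ is relatively compact in $L^p(\Omega;X)$. Moreover, if the action is not strongly ergodic, there is a branch-pasting sequence $(\Gamma_{A_n})_n$ with $\|\mathbf G(\Gamma_{A_n})\|_{p,S}\to0$ and with no strongly convergent subsequence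 in $L^p(\Omega;X)$.
   Context: $L^p(\Omega;X)$ is the set of a.e.-classes of strongly measurable $u:\Omega\to X$ with $\int_\Omega d(u,x_\circ)^p\,d\mathbb P<\infty$ for a fixed $x_\circ\in X$, with metric $D_p(u,v)=\bigl(\int_\Omega d(u,v)^p\,d\mathbb P\bigr)^{1/p}$; strong convergence means convergence in $D_p$. A measurable one-step residual means that $(\omega,x,y)\mapsto G^s_\omega(x,y)$ is measurable. For a section $\Gamma:\Omega\to X$, $(G^s(\Gamma))(\omega)=G^s_\omega(\Gamma(\omega),\Gamma(s\omega))$, and $\|\mathbf G(\Gamma)\|_{p,S}^p=\sum_{s\in S}\|G^s(\Gamma)\|_{L^p}^p$, with $\|G^s(\Gamma)\|_{L^p}^p=\int_\Omega\|G^s_\omega(\Gamma(\omega),\Gamma(s\omega))\|_{Y_s}^p\,d\mathbb P$. A sequence of measurable sets $A_n$ is asymptotically invariant if $\mathbb P(A_n\triangle g^{-1}A_n)\to0$ for every $g\in\Lambda$. An ergodic probability-measure-preserving action is strongly ergodic if every asymptotically invariant sequence satisfies $\mathbb P(A_n)(1-\mathbb P(A_n))\to0$. *)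

theory Defs
  imports
    "HOL-Probability.Probability"
    "HOL-Algebra.Group_Action"
    "HOL-Algebra.Generated_Groups"
begin

section \<open>Standard probability spaces and probability-measure-preserving actions\<close>

definition standard_borel_space :: "'w measure \<Rightarrow> bool" where
  "standard_borel_space M \<longleftrightarrow>
    (\<exists>T. topspace T = space M \<and> completely_metrizable_space T \<and> second_countable T \<and>
         sets M = sigma_sets (space M) {U. openin T U})"

text \<open>The literature uses both a Borel probability measure on a standard Borel space and its
  completion; both are admitted.\<close>

definition standard_prob_space :: "'w measure \<Rightarrow> bool" where
  "standard_prob_space M \<longleftrightarrow>
    prob_space M \<and> (\<exists>N. standard_borel_space N \<and> (M = N \<or> M = completion N))"

definition pmp_action :: "('g, 'b) monoid_scheme \<Rightarrow> 'w measure \<Rightarrow> ('g \<Rightarrow> 'w \<Rightarrow> 'w) \<Rightarrow> bool" where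
  "pmp_action \<Lambda> M \<phi> \<longleftrightarrow>
    prob_space M \<and> group_action \<Lambda> (space M) \<phi> \<and>
    (\<forall>g\<in>carrier \<Lambda>. \<phi> g \<in> measurable M M \<and> distr M M (\<phi> g) = M)"

definition ergodic_action :: "('g, 'b) monoid_scheme \<Rightarrow> 'w measure \<Rightarrow> ('g \<Rightarrow> 'w \<Rightarrow> 'w) \<Rightarrow> bool" where
  "ergodic_action \<Lambda> M \<phi> \<longleftrightarrow>
    pmp_action \<Lambda> M \<phi> \<and>
    (\<forall>A\<in>sets M. (\<forall>g\<in>carrier \<Lambda>. \<phi> g -` A \<inter> space M = A) \<longrightarrow> measure M A \<in> {0, 1})"

definition asymptotically_invariant ::
  "('g, 'b) monoid_scheme \<Rightarrow> 'w measure \<Rightarrow> ('g \<Rightarrow> 'w \<Rightarrow> 'w) \<Rightarrow> (nat \<Rightarrow> 'w set) \<Rightarrow> bool" where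
  "asymptotically_invariant \<Lambda> M \<phi> A \<longleftrightarrow>
    (\<forall>n. A n \<in> sets M) \<and>
    (\<forall>g\<in>carrier \<Lambda>. (\<lambda>n. measure M (sym_diff (A n) (\<phi> g -` A n \<inter> space M))) \<longlonglongrightarrow> 0)"

definition strongly_ergodic :: "('g, 'b) monoid_scheme \<Rightarrow> 'w measure \<Rightarrow> ('g \<Rightarrow> 'w \<Rightarrow> 'w) \<Rightarrow> bool" where
  "strongly_ergodic \<Lambda> M \<phi> \<longleftrightarrow>
    ergodic_action \<Lambda> M \<phi> \<and>
    (\<forall>A. asymptotically_invariant \<Lambda> M \<phi> A \<longrightarrow>
         (\<lambda>n. measure M (A n) * (1 - measure M (A n))) \<longlonglongrightarrow> 0)"


section \<open>The metric space $L^p(\Omega;X)$\<close>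

definition strongly_measurable :: "'w measure \<Rightarrow> ('w \<Rightarrow> 'x::metric_space) \<Rightarrow> bool" where
  "strongly_measurable M u \<longleftrightarrow>
    (\<exists>s. (\<forall>n. simple_function M (s n)) \<and> (\<forall>\<omega>\<in>space M. (\<lambda>n. s n \<omega>) \<longlonglongrightarrow> u \<omega>))"

lemma strongly_measurable_iff_borel_measurable:
  fixes u :: "'w \<Rightarrow> 'x::polish_space"
  shows "strongly_measurable M u \<longleftrightarrow> u \<in> borel_measurable M"
proof
  assume "strongly_measurable M u"
  then obtain s where s: "\<And>n. simple_function M (s n)"
    "\<And>\<omega>. \<omega> \<in> space M \<Longrightarrow> (\<lambda>n. s n \<omega>) \<longlonglongrightarrow> u \<omega>"
    unfolding strongly_measurable_def by auto
  show "u \<in> borel_measurable M"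
    by (rule borel_measurable_LIMSEQ_metric[of s])
       (use s in \<open>auto intro: borel_measurable_simple_function\<close>)
next
  assume "u \<in> borel_measurable M"
  from borel_measurable_implies_sequence_metric[OF this, of undefined]
  show "strongly_measurable M u"
    unfolding strongly_measurable_def by blast
qed

definition Lp_fun :: "real \<Rightarrow> 'w measure \<Rightarrow> 'x::polish_space \<Rightarrow> ('w \<Rightarrow> 'x) set" where
  "Lp_fun p M x\<^sub>0 =
    {u. strongly_measurable M u \<and> integrable M (\<lambda>\<omega>. dist (u \<omega>) x\<^sub>0 powr p)}"

definition Lp_rel :: "real \<Rightarrow> 'w measure \<Rightarrow> 'x::polish_space \<Rightarrow> (('w \<Rightarrow> 'x) \<times> ('w \<Rightarrow> 'x)) set" where
  "Lp_rel p M x\<^sub>0 =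
    {(u, v). u \<in> Lp_fun p M x\<^sub>0 \<and> v \<in> Lp_fun p M x\<^sub>0 \<and> (AE \<omega> in M. u \<omega> = v \<omega>)}"

definition Lp_space :: "real \<Rightarrow> 'w measure \<Rightarrow> 'x::polish_space \<Rightarrow> ('w \<Rightarrow> 'x) set set" where
  "Lp_space p M x\<^sub>0 = Lp_fun p M x\<^sub>0 // Lp_rel p M x\<^sub>0"

definition Lp_class :: "real \<Rightarrow> 'w measure \<Rightarrow> 'x::polish_space \<Rightarrow> ('w \<Rightarrow> 'x) \<Rightarrow> ('w \<Rightarrow> 'x) set" where
  "Lp_class p M x\<^sub>0 u = Lp_rel p M x\<^sub>0 `` {u}"

definition Lp_dist_fun :: "real \<Rightarrow> 'w measure \<Rightarrow> ('w \<Rightarrow> 'x::polish_space) \<Rightarrow> ('w \<Rightarrow> 'x) \<Rightarrow> real" where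
  "Lp_dist_fun p M u v = (\<integral>\<omega>. dist (u \<omega>) (v \<omega>) powr p \<partial>M) powr (1 / p)"

text \<open>Independent of the choice of representatives, by \<open>Lp_dist_class\<close> below.\<close>

definition Lp_dist :: "real \<Rightarrow> 'w measure \<Rightarrow> ('w \<Rightarrow> 'x::polish_space) set \<Rightarrow> ('w \<Rightarrow> 'x) set \<Rightarrow> real" where
  "Lp_dist p M U V = Lp_dist_fun p M (SOME u. u \<in> U) (SOME v. v \<in> V)"

definition Lp_topology :: "real \<Rightarrow> 'w measure \<Rightarrow> 'x::polish_space \<Rightarrow> ('w \<Rightarrow> 'x) set topology" where
  "Lp_topology p M x\<^sub>0 = Metric_space.mtopology (Lp_space p M x\<^sub>0) (Lp_dist p M)"

definition relatively_compact_in :: "'a topology \<Rightarrow> 'a set \<Rightarrow> bool" where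
  "relatively_compact_in T K \<longleftrightarrow> K \<subseteq> topspace T \<and> compactin T (T closure_of K)"

lemma equiv_Lp_rel: "equiv (Lp_fun p M x\<^sub>0) (Lp_rel p M x\<^sub>0)"
proof (rule equivI)
  show "trans (Lp_rel p M x\<^sub>0)"
  proof (rule transI)
    fix u v w assume "(u, v) \<in> Lp_rel p M x\<^sub>0" "(v, w) \<in> Lp_rel p M x\<^sub>0"
    then have "u \<in> Lp_fun p M x\<^sub>0" "w \<in> Lp_fun p M x\<^sub>0"
      and "AE \<omega> in M. u \<omega> = v \<omega>" "AE \<omega> in M. v \<omega> = w \<omega>"
      by (auto simp: Lp_rel_def)
    moreover from this(3,4) have "AE \<omega> in M. u \<omega> = w \<omega>" by eventually_elim simp
    ultimately show "(u, w) \<in> Lp_rel p M x\<^sub>0" by (simp add: Lp_rel_def)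
  qed
qed (auto simp: Lp_rel_def refl_on_def sym_def eq_commute)

lemma Lp_fun_measurable: "u \<in> Lp_fun p M x\<^sub>0 \<Longrightarrow> u \<in> borel_measurable M"
  by (simp add: Lp_fun_def strongly_measurable_iff_borel_measurable)

lemma Lp_dist_fun_cong:
  assumes "(u, u') \<in> Lp_rel p M x\<^sub>0" "(v, v') \<in> Lp_rel p M x\<^sub>0"
  shows "Lp_dist_fun p M u v = Lp_dist_fun p M u' v'"
proof -
  have [measurable]: "u \<in> borel_measurable M" "u' \<in> borel_measurable M"
    "v \<in> borel_measurable M" "v' \<in> borel_measurable M"
    using assms by (auto simp: Lp_rel_def intro: Lp_fun_measurable)
  have "AE \<omega> in M. u \<omega> = u' \<omega>" "AE \<omega> in M. v \<omega> = v' \<omega>"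
    using assms by (auto simp: Lp_rel_def)
  then have "AE \<omega> in M. dist (u \<omega>) (v \<omega>) powr p = dist (u' \<omega>) (v' \<omega>) powr p"
    by eventually_elim simp
  then have "(\<integral>\<omega>. dist (u \<omega>) (v \<omega>) powr p \<partial>M) = (\<integral>\<omega>. dist (u' \<omega>) (v' \<omega>) powr p \<partial>M)"
    by (intro integral_cong_AE) auto
  then show ?thesis by (simp add: Lp_dist_fun_def)
qed

lemma Lp_dist_class:
  assumes "u \<in> Lp_fun p M x\<^sub>0" "v \<in> Lp_fun p M x\<^sub>0"
  shows "Lp_dist p M (Lp_class p M x\<^sub>0 u) (Lp_class p M x\<^sub>0 v) = Lp_dist_fun p M u v"
proof -
  have some: "(w, SOME x. x \<in> Lp_class p M x\<^sub>0 w) \<in> Lp_rel p M x\<^sub>0" if "w \<in> Lp_fun p M x\<^sub>0" for w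
  proof -
    have "w \<in> Lp_class p M x\<^sub>0 w"
      unfolding Lp_class_def using equiv_class_self[OF equiv_Lp_rel that] .
    then have "(SOME x. x \<in> Lp_class p M x\<^sub>0 w) \<in> Lp_class p M x\<^sub>0 w"
      by (rule someI[where P = "\<lambda>x. x \<in> Lp_class p M x\<^sub>0 w"])
    then show ?thesis by (simp add: Lp_class_def)
  qed
  show ?thesis
    unfolding Lp_dist_def using Lp_dist_fun_cong[OF some some, OF assms] by simp
qed

lemma convex_powr:
  fixes a b t p :: real
  assumes "1 \<le> p" "0 \<le> a" "0 \<le> b" "0 \<le> t" "t \<le> 1"
  shows "(t * a + (1 - t) * b) powr p \<le> t * a powr p + (1 - t) * b powr p"
proof -
  have le: "c powr p \<le> c" if "0 \<le> c" "c \<le> 1" for c :: real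
    using powr_mono'[of 1 p c] that assms by simp
  consider "a = 0" | "b = 0" | "a > 0" "b > 0" using assms by linarith
  then show ?thesis
  proof cases
    case 1
    then show ?thesis
      using mult_right_mono[OF le[of "1 - t"], of "b powr p"] assms by (simp add: powr_mult)
  next
    case 2
    then show ?thesis
      using mult_right_mono[OF le[of t], of "a powr p"] assms by (simp add: powr_mult)
  next
    case 3
    then show ?thesis
      using convex_onD[OF powr_convex[OF assms(1)], of "1 - t" a b] assms by (simp add: algebra_simps)
  qed
qed

lemma integrable_add_powr:
  fixes f g :: "'w \<Rightarrow> real"
  assumes "1 \<le> p" and [measurable]: "f \<in> borel_measurable M" "g \<in> borel_measurable M"
    and nn: "\<And>\<omega>. 0 \<le> f \<omega>" "\<And>\<omega>. 0 \<le> g \<omega>"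
    and int: "integrable M (\<lambda>\<omega>. f \<omega> powr p)" "integrable M (\<lambda>\<omega>. g \<omega> powr p)"
  shows "integrable M (\<lambda>\<omega>. (f \<omega> + g \<omega>) powr p)"
proof (rule Bochner_Integration.integrable_bound)
  show "integrable M (\<lambda>\<omega>. 2 powr p * (f \<omega> powr p + g \<omega> powr p))" using int by simp
  have "(f \<omega> + g \<omega>) powr p \<le> 2 powr p * (f \<omega> powr p + g \<omega> powr p)" for \<omega>
  proof -
    have "(f \<omega> + g \<omega>) powr p = 2 powr p * (1/2 * f \<omega> + (1 - 1/2) * g \<omega>) powr p"
      using nn[of \<omega>] by (simp add: powr_mult[symmetric] algebra_simps)
    also have "\<dots> \<le> 2 powr p * (1/2 * f \<omega> powr p + (1 - 1/2) * g \<omega> powr p)"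
      using assms(1) nn[of \<omega>] by (intro mult_left_mono convex_powr) auto
    also have "\<dots> \<le> 2 powr p * (f \<omega> powr p + g \<omega> powr p)"
      by (intro mult_left_mono add_mono) auto
    finally show ?thesis .
  qed
  then show "AE \<omega> in M. norm ((f \<omega> + g \<omega>) powr p) \<le> norm (2 powr p * (f \<omega> powr p + g \<omega> powr p))"
    by auto
qed measurable

lemma Minkowski_powr:
  fixes f g :: "'w \<Rightarrow> real"
  assumes p: "1 \<le> p" and [measurable]: "f \<in> borel_measurable M" "g \<in> borel_measurable M"
    and nn: "\<And>\<omega>. 0 \<le> f \<omega>" "\<And>\<omega>. 0 \<le> g \<omega>"
    and int: "integrable M (\<lambda>\<omega>. f \<omega> powr p)" "integrable M (\<lambda>\<omega>. g \<omega> powr p)"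
  shows "(\<integral>\<omega>. (f \<omega> + g \<omega>) powr p \<partial>M) powr (1 / p)
    \<le> (\<integral>\<omega>. f \<omega> powr p \<partial>M) powr (1 / p) + (\<integral>\<omega>. g \<omega> powr p \<partial>M) powr (1 / p)"
proof -
  let ?I = "\<lambda>h. \<integral>\<omega>. h \<omega> powr p \<partial>M"
  define F G where "F = ?I f powr (1 / p)" and "G = ?I g powr (1 / p)"
  have Fp: "F powr p = ?I f" and Gp: "G powr p = ?I g"
    using p by (auto simp: F_def G_def powr_powr integral_nonneg_AE)
  have F0: "F \<ge> 0" "G \<ge> 0" by (auto simp: F_def G_def)
  have zero: "AE \<omega> in M. h \<omega> = 0"
    if "integrable M (\<lambda>\<omega>. h \<omega> powr p)" "?I h = 0" for h :: "'w \<Rightarrow> real"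
    using integral_nonneg_eq_0_iff_AE[OF that(1)] that(2) by simp
  consider "F = 0" | "G = 0" | "F > 0" "G > 0" using F0 by linarith
  then show ?thesis
  proof cases
    case 1
    then have "AE \<omega> in M. f \<omega> = 0" using Fp int by (intro zero) auto
    then have "AE \<omega> in M. (f \<omega> + g \<omega>) powr p = g \<omega> powr p" by eventually_elim simp
    then have "?I (\<lambda>\<omega>. f \<omega> + g \<omega>) = ?I g" by (intro integral_cong_AE) auto
    then show ?thesis by simp
  next
    case 2
    then have "AE \<omega> in M. g \<omega> = 0" using Gp int by (intro zero) auto
    then have "AE \<omega> in M. (f \<omega> + g \<omega>) powr p = f \<omega> powr p" by eventually_elim simp
    then have "?I (\<lambda>\<omega>. f \<omega> + g \<omega>) = ?I f" by (intro integral_cong_AE) auto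
    then show ?thesis by simp
  next
    case 3
    define t where "t = F / (F + G)"
    have t: "0 \<le> t" "t \<le> 1" "1 - t = G / (F + G)" using 3 by (auto simp: t_def field_simps)
    have pt: "(f \<omega> + g \<omega>) powr p
      \<le> (F + G) powr p * (t * (f \<omega> powr p / ?I f) + (1 - t) * (g \<omega> powr p / ?I g))" for \<omega>
    proof -
      have "f \<omega> + g \<omega> = (F + G) * (t * (f \<omega> / F) + (1 - t) * (g \<omega> / G))"
        unfolding t(3) unfolding t_def using 3 by (simp add: distrib_left)
      then have "(f \<omega> + g \<omega>) powr p = (F + G) powr p * (t * (f \<omega> / F) + (1 - t) * (g \<omega> / G)) powr p"
        by (simp only: powr_mult)
      also have "\<dots> \<le> (F + G) powr p * (t * (f \<omega> / F) powr p + (1 - t) * (g \<omega> / G) powr p)"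
        using p nn[of \<omega>] 3 t by (intro mult_left_mono convex_powr) auto
      finally show ?thesis using nn[of \<omega>] 3 by (simp add: powr_divide Fp Gp)
    qed
    have pos: "?I f > 0" "?I g > 0" using 3 by (auto simp flip: Fp Gp)
    have "?I (\<lambda>\<omega>. f \<omega> + g \<omega>)
      \<le> (\<integral>\<omega>. (F + G) powr p * (t * (f \<omega> powr p / ?I f) + (1 - t) * (g \<omega> powr p / ?I g)) \<partial>M)"
      using pt int by (intro integral_mono integrable_add_powr p nn) auto
    also have "\<dots> = (F + G) powr p * (t * (?I f / ?I f) + (1 - t) * (?I g / ?I g))"
      using int by simp
    also have "\<dots> = (F + G) powr p" using pos by simp
    finally have "?I (\<lambda>\<omega>. f \<omega> + g \<omega>) powr (1 / p) \<le> ((F + G) powr p) powr (1 / p)"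
      using p by (intro powr_mono2) (auto intro: integral_nonneg_AE)
    also have "\<dots> = F + G" using p 3 by (simp add: powr_powr)
    finally show ?thesis by (simp add: F_def G_def)
  qed
qed

lemma Lp_dist_integrable:
  assumes p: "1 \<le> p" and u: "u \<in> Lp_fun p M x\<^sub>0" and v: "v \<in> Lp_fun p M x\<^sub>0"
  shows "integrable M (\<lambda>\<omega>. dist (u \<omega>) (v \<omega>) powr p)"
proof (rule Bochner_Integration.integrable_bound)
  have [measurable]: "u \<in> borel_measurable M" "v \<in> borel_measurable M"
    using u v by (auto intro: Lp_fun_measurable)
  show "(\<lambda>\<omega>. dist (u \<omega>) (v \<omega>) powr p) \<in> borel_measurable M" by measurable
  show "integrable M (\<lambda>\<omega>. (dist (u \<omega>) x\<^sub>0 + dist (v \<omega>) x\<^sub>0) powr p)"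
    using u v by (intro integrable_add_powr p) (auto simp: Lp_fun_def)
  show "AE \<omega> in M. norm (dist (u \<omega>) (v \<omega>) powr p)
      \<le> norm ((dist (u \<omega>) x\<^sub>0 + dist (v \<omega>) x\<^sub>0) powr p)"
    using p by (auto intro!: powr_mono2 dist_triangle2)
qed

lemma Metric_space_Lp:
  assumes p: "1 \<le> p"
  shows "Metric_space (Lp_space p M x\<^sub>0) (Lp_dist p M :: ('w \<Rightarrow> 'x::polish_space) set \<Rightarrow> _)"
proof -
  let ?L = "Lp_fun p M x\<^sub>0" and ?S = "Lp_space p M x\<^sub>0" and ?c = "Lp_class p M x\<^sub>0"
  have rep: "\<exists>u\<in>?L. U = ?c u" if "U \<in> ?S" for U
    using that by (auto simp: Lp_space_def Lp_class_def quotient_def)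
  have nonneg: "0 \<le> Lp_dist_fun p M u v" for u v :: "'w \<Rightarrow> 'x" by (simp add: Lp_dist_fun_def)
  have comm: "Lp_dist_fun p M u v = Lp_dist_fun p M v u" for u v :: "'w \<Rightarrow> 'x"
    by (simp add: Lp_dist_fun_def dist_commute)
  have zero: "Lp_dist_fun p M u v = 0 \<longleftrightarrow> ?c u = ?c v" if "u \<in> ?L" "v \<in> ?L" for u v
  proof -
    have "Lp_dist_fun p M u v = 0 \<longleftrightarrow> (AE \<omega> in M. u \<omega> = v \<omega>)"
      using integral_nonneg_eq_0_iff_AE[OF Lp_dist_integrable[OF p that]]
      by (simp add: Lp_dist_fun_def)
    also have "\<dots> \<longleftrightarrow> (u, v) \<in> Lp_rel p M x\<^sub>0" using that by (simp add: Lp_rel_def)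
    also have "\<dots> \<longleftrightarrow> ?c u = ?c v"
      unfolding Lp_class_def using eq_equiv_class_iff[OF equiv_Lp_rel that] by simp
    finally show ?thesis .
  qed
  have tri: "Lp_dist_fun p M u w \<le> Lp_dist_fun p M u v + Lp_dist_fun p M v w"
    if "u \<in> ?L" "v \<in> ?L" "w \<in> ?L" for u v w
  proof -
    have [measurable]: "u \<in> borel_measurable M" "v \<in> borel_measurable M" "w \<in> borel_measurable M"
      using that by (auto intro: Lp_fun_measurable)
    note ints = Lp_dist_integrable[OF p that(1,2)] Lp_dist_integrable[OF p that(2,3)]
      Lp_dist_integrable[OF p that(1,3)]
    have "Lp_dist_fun p M u w
        \<le> (\<integral>\<omega>. (dist (u \<omega>) (v \<omega>) + dist (v \<omega>) (w \<omega>)) powr p \<partial>M) powr (1 / p)"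
      unfolding Lp_dist_fun_def using p ints
      by (intro powr_mono2 integral_mono integrable_add_powr)
         (auto intro!: integral_nonneg_AE powr_mono2 dist_triangle)
    also have "\<dots> \<le> Lp_dist_fun p M u v + Lp_dist_fun p M v w"
      unfolding Lp_dist_fun_def using ints by (intro Minkowski_powr p) auto
    finally show ?thesis .
  qed
  note D = Lp_dist_class[of _ p M x\<^sub>0]
  show ?thesis
  proof
    fix U V :: "('w \<Rightarrow> 'x) set"
    show "0 \<le> Lp_dist p M U V" "Lp_dist p M U V = Lp_dist p M V U"
      by (simp_all add: Lp_dist_def nonneg comm)
  next
    fix U V :: "('w \<Rightarrow> 'x) set"
    assume "U \<in> ?S" "V \<in> ?S"
    then show "Lp_dist p M U V = 0 \<longleftrightarrow> U = V"
      using rep zero D by metis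
  next
    fix U V W :: "('w \<Rightarrow> 'x) set"
    assume "U \<in> ?S" "V \<in> ?S" "W \<in> ?S"
    then show "Lp_dist p M U W \<le> Lp_dist p M U V + Lp_dist p M V W"
      using rep tri D by metis
  qed
qed


section \<open>Residuals and branch pastings\<close>

text \<open>The target spaces \<open>Y s\<close> of a residual are closed subspaces of one Banach space \<open>'y\<close>. This is no
  restriction: a finite family of Banach spaces embeds isometrically into its $\ell^\infty$-sum.\<close>

text \<open>Only applied to sections whose residuals lie in $L^p$, such as the branch pastings under the
  hypothesis $q_s \in L^p$; the Bochner integral would be \<open>0\<close> on a non-integrable residual.\<close>

definition residual_norm ::
  "real \<Rightarrow> 'w measure \<Rightarrow> ('g \<Rightarrow> 'w \<Rightarrow> 'w) \<Rightarrow> 'g set \<Rightarrow> ('g \<Rightarrow> 'w \<Rightarrow> 'x \<Rightarrow> 'x \<Rightarrow> 'y::real_normed_vector)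
    \<Rightarrow> ('w \<Rightarrow> 'x) \<Rightarrow> real" where
  "residual_norm p M \<phi> S G \<Gamma> =
    (\<Sum>s\<in>S. \<integral>\<omega>. norm (G s \<omega> (\<Gamma> \<omega>) (\<Gamma> (\<phi> s \<omega>))) powr p \<partial>M) powr (1 / p)"

definition branch_paste :: "('w \<Rightarrow> 'x) \<Rightarrow> ('w \<Rightarrow> 'x) \<Rightarrow> 'w set \<Rightarrow> 'w \<Rightarrow> 'x" where
  "branch_paste \<xi>\<^sub>0 \<xi>\<^sub>1 A \<omega> = (if \<omega> \<in> A then \<xi>\<^sub>1 \<omega> else \<xi>\<^sub>0 \<omega>)"

end

theory Submission
  imports Defs
begin

text \<open>
  The residual of a branch pasting in direction \<open>s\<close> vanishes almost everywhere except at the points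
  \<open>\<omega>\<close> for which exactly one of \<open>\<omega>\<close> and \<open>s\<omega>\<close> lies in \<open>A\<close>; these form the set
  \<open>A \<triangle> s\<^sup>-\<^sup>1A\<close>, and on it the norm of the residual lies between \<open>r\<^sub>s\<close> and \<open>q\<^sub>s\<close>. Because
  \<open>q\<^sub>s\<^sup>p\<close> is integrable and \<open>r\<^sub>s\<^sup>p\<close> is positive almost everywhere, the residuals tend to zero exactly
  when the measures of these sets do (\<open>one_step_residual_tendsto_0_iff\<close>). Smallness on generators
  spreads to the whole group, so vanishing residual means that the pasting sets are asymptotically
  invariant (\<open>asymptotically_invariant_iff_generators\<close>). In the same way, the \<open>p\<close>-th
  power of the distance between two branch pastings in \<open>L\<^sup>p\<close> is the integral of \<open>d(\<xi>\<^sub>0, \<xi>\<^sub>1)\<^sup>p\<close> over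
  the symmetric difference of their sets.

  If the action is strongly ergodic, asymptotically invariant sets have measure close to 0 or to 1,
  so their pastings approach the two-point set formed by the classes of \<open>\<xi>\<^sub>0\<close> and \<open>\<xi>\<^sub>1\<close>. Adding these
  two points to the sequence gives a compact set (\<open>branch_pastings_relatively_compact\<close>).

  If it is not, some asymptotically invariant sequence has \<open>P(A\<^sub>n)(1 - P(A\<^sub>n))\<close> bounded away from 0.
  Suppose that a subsequence of its pastings converged to \<open>u\<close>. Then \<open>A\<^sub>n\<close> would converge in measure,
  along the subsequence, to \<open>B = {u = \<xi>\<^sub>1}\<close> (\<open>branch_pastings_limit_set\<close>), and \<open>B\<close> would be invariant
  up to null sets. By ergodicity \<open>P(B)\<close> would be 0 or 1
  (\<open>measure_limit_of_asymptotically_invariant\<close>), contradicting the lower bound. In particular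
  relative compactness fails for this sequence, so the implication from compactness to strong
  ergodicity follows from the same construction.
\<close>

section \<open>Integrals over small sets\<close>

text \<open>
  Absolute continuity in a form that is used with either function equal to 1. Where \<open>g\<close> vanishes
  so does \<open>f\<close>, hence the excess \<open>max 0 (f - k g)\<close> tends to 0 almost everywhere as \<open>k \<rightarrow> \<infinity>\<close>, dominated
  by \<open>f\<close>; and the integral of \<open>f\<close> over a set is at most \<open>k\<close> times that of \<open>g\<close> plus the integral of the excess.
\<close>

lemma integral_over_small_sets:
  fixes f g :: "'w \<Rightarrow> real"
  assumes f: "integrable M f" "\<And>x. 0 \<le> f x" and g: "integrable M g" "\<And>x. 0 \<le> g x"
    and ac: "AE x in M. g x = 0 \<longrightarrow> f x = 0"
    and B: "\<And>n. B n \<in> sets M"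
    and lim: "(\<lambda>n. \<integral>x. g x * indicator (B n) x \<partial>M) \<longlonglongrightarrow> 0"
  shows "(\<lambda>n. \<integral>x. f x * indicator (B n) x \<partial>M) \<longlonglongrightarrow> 0"
proof -
  let ?excess = "\<lambda>k x. max 0 (f x - real k * g x)"
  have [measurable]: "f \<in> borel_measurable M" "g \<in> borel_measurable M" using f g by auto
  have int: "integrable M (?excess k)" for k
    using f g by (intro Bochner_Integration.integrable_bound[OF f(1)]) (auto intro!: AE_I2)
  have pointwise: "(\<lambda>k. ?excess k x) \<longlonglongrightarrow> 0" if "g x = 0 \<longrightarrow> f x = 0" for x
  proof (cases "g x = 0")
    case True
    then show ?thesis using that by simp
  next
    case False
    then have "g x > 0" using g(2)[of x] by simp
    then obtain k\<^sub>0 where "f x < real k\<^sub>0 * g x" using reals_Archimedean3 by blast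
    moreover have "real k\<^sub>0 * g x \<le> real k * g x" if "k \<ge> k\<^sub>0" for k
      using that \<open>g x > 0\<close> by (intro mult_right_mono) auto
    ultimately have "?excess k x = 0" if "k \<ge> k\<^sub>0" for k
      using that by (force simp: max_def)
    then show ?thesis by (intro tendsto_eventually eventually_sequentiallyI) blast
  qed
  have "(\<lambda>k. \<integral>x. ?excess k x \<partial>M) \<longlonglongrightarrow> (\<integral>x. 0 \<partial>M)"
  proof (rule integral_dominated_convergence[where w = f])
    show "AE x in M. (\<lambda>k. ?excess k x) \<longlonglongrightarrow> 0"
      using ac by eventually_elim (rule pointwise)
    show "AE x in M. norm (?excess k x) \<le> f x" for k
      using f g by (auto intro!: AE_I2)
  qed (use f in measurable)
  then have excess: "(\<lambda>k. \<integral>x. ?excess k x \<partial>M) \<longlonglongrightarrow> 0" by simp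
  have bound: "(\<integral>x. f x * indicator (B n) x \<partial>M)
      \<le> real k * (\<integral>x. g x * indicator (B n) x \<partial>M) + (\<integral>x. ?excess k x \<partial>M)" for n k
  proof -
    note ints = integrable_mult_indicator[OF B f(1)] integrable_mult_indicator[OF B g(1)]
    have "(\<integral>x. f x * indicator (B n) x \<partial>M)
        \<le> (\<integral>x. real k * (g x * indicator (B n) x) + ?excess k x \<partial>M)"
      using ints int[of k]
      by (intro integral_mono) (auto simp: mult.commute split: split_indicator)
    also have "\<dots> = real k * (\<integral>x. g x * indicator (B n) x \<partial>M) + (\<integral>x. ?excess k x \<partial>M)"
      using ints int[of k] by (subst Bochner_Integration.integral_add) (auto simp: mult.commute)
    finally show ?thesis .
  qed
  show ?thesis
  proof (rule order_tendstoI)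
    fix e :: real assume "e < 0"
    then show "\<forall>\<^sub>F n in sequentially. e < (\<integral>x. f x * indicator (B n) x \<partial>M)"
      by (intro always_eventually allI less_le_trans[OF _ integral_nonneg_AE]) (use f in auto)
  next
    fix e :: real assume "0 < e"
    then have "\<forall>\<^sub>F k in sequentially. (\<integral>x. ?excess k x \<partial>M) < e / 2"
      using order_tendstoD(2)[OF excess, of "e / 2"] by simp
    then obtain k where k: "(\<integral>x. ?excess k x \<partial>M) < e / 2"
      using eventually_happens by fastforce
    have "(\<lambda>n. real k * (\<integral>x. g x * indicator (B n) x \<partial>M)) \<longlonglongrightarrow> 0"
      using tendsto_mult_right_zero[OF lim] .
    then have "\<forall>\<^sub>F n in sequentially. real k * (\<integral>x. g x * indicator (B n) x \<partial>M) < e / 2"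
      using order_tendstoD(2)[of _ 0 _ "e / 2"] \<open>0 < e\<close> by simp
    then show "\<forall>\<^sub>F n in sequentially. (\<integral>x. f x * indicator (B n) x \<partial>M) < e"
    proof eventually_elim
      case (elim n)
      then show ?case using bound[of n k] k by linarith
    qed
  qed
qed

lemma measure_eq_integral_indicator:
  "B \<in> sets M \<Longrightarrow> measure M B = (\<integral>x. 1 * indicator B x \<partial>M)"
  using sets.sets_into_space[of B M] by (simp add: Int_absorb2)

lemma integral_tendsto_0_if_measure:
  fixes h :: "'w \<Rightarrow> real"
  assumes M: "finite_measure M" and h: "integrable M h" "\<And>x. 0 \<le> h x"
    and B: "\<And>n. B n \<in> sets M" and lim: "(\<lambda>n. measure M (B n)) \<longlonglongrightarrow> 0"
  shows "(\<lambda>n. \<integral>x. h x * indicator (B n) x \<partial>M) \<longlonglongrightarrow> 0"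
proof -
  interpret finite_measure M by (rule M)
  show ?thesis
    by (rule integral_over_small_sets[OF h _ _ _ B lim[unfolded measure_eq_integral_indicator[OF B]]])
       auto
qed

lemma measure_tendsto_0_if_integral:
  fixes h :: "'w \<Rightarrow> real"
  assumes M: "finite_measure M" and h: "integrable M h" "\<And>x. 0 \<le> h x" "AE x in M. 0 < h x"
    and B: "\<And>n. B n \<in> sets M" and lim: "(\<lambda>n. \<integral>x. h x * indicator (B n) x \<partial>M) \<longlonglongrightarrow> 0"
  shows "(\<lambda>n. measure M (B n)) \<longlonglongrightarrow> 0"
proof -
  interpret finite_measure M by (rule M)
  have "AE x in M. h x = 0 \<longrightarrow> (1::real) = 0" using h(3) by eventually_elim simp
  then show ?thesis
    unfolding measure_eq_integral_indicator[OF B]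
    by (intro integral_over_small_sets[OF _ _ h(1,2) _ B lim]) auto
qed

section \<open>Almost invariant sets\<close>

text \<open>
  Every element is the value of a word in the generators and their inverses. Countability of the
  group is what later allows an almost invariant set to be corrected on a null set.
\<close>

lemma countable_generate:
  assumes "group G" "countable S" "S \<subseteq> carrier G"
  shows "countable (generate G S)"
proof -
  interpret group G by (rule assms)
  let ?L = "lists (S \<union> m_inv G ` S)"
  let ?word = "\<lambda>xs. foldr (\<otimes>\<^bsub>G\<^esub>) xs \<one>\<^bsub>G\<^esub>"
  have letters: "S \<union> m_inv G ` S \<subseteq> carrier G" using assms by auto
  have closed: "?word xs \<in> carrier G" if "xs \<in> ?L" for xs
    using that letters by induction auto
  have append: "?word (xs @ ys) = ?word xs \<otimes>\<^bsub>G\<^esub> ?word ys" if "xs \<in> ?L" "ys \<in> ?L" for xs ys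
    using that(1)
  proof induction
    case Nil
    then show ?case using closed[OF that(2)] by simp
  next
    case (Cons a xs)
    then show ?case using closed[OF that(2)] closed[OF Cons(2)] letters by (auto simp: m_assoc)
  qed
  have "g \<in> ?word ` ?L" if "g \<in> generate G S" for g
    using that
  proof induction
    case one
    show ?case by (rule image_eqI[where x = "[]"]) auto
  next
    case (incl h)
    then show ?case using assms(3) by (intro image_eqI[where x = "[h]"]) auto
  next
    case (inv h)
    then show ?case using assms(3) by (intro image_eqI[where x = "[inv\<^bsub>G\<^esub> h]"]) auto
  next
    case (eng h1 h2)
    then obtain xs ys where "xs \<in> ?L" "ys \<in> ?L" "h1 = ?word xs" "h2 = ?word ys" by blast
    then show ?case using append by (intro image_eqI[where x = "xs @ ys"]) auto
  qed
  then have "generate G S \<subseteq> ?word ` ?L" by blast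
  moreover have "countable (?word ` ?L)" using assms(2) by auto
  ultimately show ?thesis by (rule countable_subset)
qed

text \<open>
  The points that one step of \<open>T\<close> carries into \<open>A\<close> or out of it. This is where a branch pasting jumps
  between the two branches; elsewhere its residual is almost surely zero.
\<close>

definition displacement :: "'w measure \<Rightarrow> ('w \<Rightarrow> 'w) \<Rightarrow> 'w set \<Rightarrow> 'w set" where
  "displacement M T A = sym_diff A (T -` A \<inter> space M)"

lemma displacement_sets [measurable]:
  assumes "T \<in> measurable M M" "A \<in> sets M"
  shows "displacement M T A \<in> sets M"
  using assms unfolding displacement_def by measurable

lemma asymptotically_invariant_iff_displacement:
  "asymptotically_invariant \<Lambda> M \<phi> A \<longleftrightarrow>
    (\<forall>n. A n \<in> sets M) \<and>
    (\<forall>g\<in>carrier \<Lambda>. (\<lambda>n. measure M (displacement M (\<phi> g) (A n))) \<longlonglongrightarrow> 0)"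
  by (simp add: asymptotically_invariant_def displacement_def)

lemma measure_preserving_vimage:
  assumes "T \<in> measurable M M" "distr M M T = M" "A \<in> sets M"
  shows "measure M (T -` A \<inter> space M) = measure M A"
  using measure_distr[OF assms(1,3)] assms(2) by simp

text \<open>
  A point that crosses between \<open>A\<close> and its complement under two successive steps crosses at the first
  step or at the second. Since \<open>T'\<close> preserves the measure, the points that cross at the second step
  have the measure of the displacement of \<open>T\<close>.
\<close>

lemma measure_displacement_comp_le:
  assumes "finite_measure M" and T: "T \<in> measurable M M" and T': "T' \<in> measurable M M"
    and pres: "distr M M T' = M" and A: "A \<in> sets M"
    and comp: "\<And>\<omega>. \<omega> \<in> space M \<Longrightarrow> R \<omega> = T (T' \<omega>)"
  shows "measure M (displacement M R A)
    \<le> measure M (displacement M T' A) + measure M (displacement M T A)"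
proof -
  interpret finite_measure M by fact
  note [measurable] = T T' A
  have sp: "T' \<omega> \<in> space M" if "\<omega> \<in> space M" for \<omega> using measurable_space[OF T' that] .
  have "displacement M R A \<subseteq> displacement M T' A \<union> (T' -` displacement M T A \<inter> space M)"
    using sets.sets_into_space[OF A] by (auto simp: displacement_def comp sp)
  then have "measure M (displacement M R A)
      \<le> measure M (displacement M T' A \<union> (T' -` displacement M T A \<inter> space M))"
    by (intro finite_measure_mono) measurable
  also have "\<dots> \<le> measure M (displacement M T' A) + measure M (T' -` displacement M T A \<inter> space M)"
    by (intro measure_Un_le) measurable
  also have "measure M (T' -` displacement M T A \<inter> space M) = measure M (displacement M T A)"
    by (intro measure_preserving_vimage T' pres) measurable
  finally show ?thesis by simp
qed

text \<open>
  By subadditivity of the displacement under composition, the group elements whose displacement of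
  \<open>A n\<close> tends to 0 in measure are closed under products. Inverses of generators are generators by
  the symmetry of \<open>S\<close>.
\<close>

lemma asymptotically_invariant_iff_generators:
  assumes act: "pmp_action \<Lambda> M \<phi>" and S: "S \<subseteq> carrier \<Lambda>" "set_inv\<^bsub>\<Lambda>\<^esub> S = S" "generate \<Lambda> S = carrier \<Lambda>"
    and A: "\<And>n. A n \<in> sets M"
  shows "asymptotically_invariant \<Lambda> M \<phi> A \<longleftrightarrow>
    (\<forall>s\<in>S. (\<lambda>n. measure M (displacement M (\<phi> s) (A n))) \<longlonglongrightarrow> 0)"
proof
  assume gens: "\<forall>s\<in>S. (\<lambda>n. measure M (displacement M (\<phi> s) (A n))) \<longlonglongrightarrow> 0"
  interpret group_action \<Lambda> "space M" \<phi> using act by (simp add: pmp_action_def)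
  interpret prob_space M using act by (simp add: pmp_action_def)
  have pmp: "\<phi> g \<in> measurable M M" "distr M M (\<phi> g) = M" if "g \<in> carrier \<Lambda>" for g
    using act that by (auto simp: pmp_action_def)
  have "(\<lambda>n. measure M (displacement M (\<phi> g) (A n))) \<longlonglongrightarrow> 0" if "g \<in> generate \<Lambda> S" for g
    using that
  proof induction
    case one
    have "displacement M (\<phi> \<one>\<^bsub>\<Lambda>\<^esub>) (A n) = {}" for n
      using sets.sets_into_space[OF A[of n]] by (auto simp: displacement_def simp flip: id_eq_one)
    then show ?case by simp
  next
    case (incl h)
    then show ?case using gens by blast
  next
    case (inv h)
    then have "inv\<^bsub>\<Lambda>\<^esub> h \<in> S" using S(2) by (auto simp: SET_INV_def)
    then show ?case using gens by blast
  next
    case (eng g h)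
    then have gh: "g \<in> carrier \<Lambda>" "h \<in> carrier \<Lambda>" using S(3) by auto
    have "measure M (displacement M (\<phi> (g \<otimes>\<^bsub>\<Lambda>\<^esub> h)) (A n))
      \<le> measure M (displacement M (\<phi> h) (A n)) + measure M (displacement M (\<phi> g) (A n))" for n
      using gh A by (intro measure_displacement_comp_le pmp finite_measure_axioms composition_rule)
    then show ?case
      by (intro tendsto_sandwich[OF _ _ tendsto_const tendsto_add_zero[OF eng.IH(2,1)]]) auto
  qed
  then show "asymptotically_invariant \<Lambda> M \<phi> A"
    using A S(3) by (simp add: asymptotically_invariant_iff_displacement)
qed (use S(1) in \<open>auto simp: asymptotically_invariant_iff_displacement\<close>)

text \<open>
  Ergodicity speaks of strictly invariant sets only. The points whose entire orbit stays in \<open>B\<close> form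
  such a set, and for a countable group it differs from \<open>B\<close> by a countable union of null sets.
\<close>

lemma ergodic_almost_invariant_trivial:
  assumes erg: "ergodic_action \<Lambda> M \<phi>" and count: "countable (carrier \<Lambda>)" and B: "B \<in> sets M"
    and inv: "\<And>g. g \<in> carrier \<Lambda> \<Longrightarrow> measure M (displacement M (\<phi> g) B) = 0"
  shows "measure M B \<in> {0, 1}"
proof -
  have act: "pmp_action \<Lambda> M \<phi>" using erg by (simp add: ergodic_action_def)
  interpret group_action \<Lambda> "space M" \<phi> using act by (simp add: pmp_action_def)
  interpret group \<Lambda> using group_hom by (simp add: group_hom_def)
  interpret prob_space M using act by (simp add: pmp_action_def)
  have meas [measurable]: "\<phi> g \<in> measurable M M" if "g \<in> carrier \<Lambda>" for g
    using act that by (auto simp: pmp_action_def)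
  have sp: "\<phi> g \<omega> \<in> space M" if "g \<in> carrier \<Lambda>" "\<omega> \<in> space M" for g \<omega>
    using measurable_space[OF meas] that by blast
  define C where "C = {\<omega> \<in> space M. \<forall>g\<in>carrier \<Lambda>. \<phi> g \<omega> \<in> B}"
  have "(\<Inter>g\<in>carrier \<Lambda>. \<phi> g -` B \<inter> space M) \<in> sets M"
    using count one_closed measurable_sets[OF meas B] by (intro sets.countable_INT') blast+
  also have "(\<Inter>g\<in>carrier \<Lambda>. \<phi> g -` B \<inter> space M) = C"
    using one_closed by (auto simp: C_def)
  finally have C: "C \<in> sets M" .
  have "\<phi> h -` C \<inter> space M = C" if h: "h \<in> carrier \<Lambda>" for h
  proof (intro equalityI subsetI)
    fix \<omega> assume "\<omega> \<in> \<phi> h -` C \<inter> space M"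
    then have \<omega>: "\<omega> \<in> space M" "\<And>g. g \<in> carrier \<Lambda> \<Longrightarrow> \<phi> g (\<phi> h \<omega>) \<in> B" by (auto simp: C_def)
    have "\<phi> g \<omega> \<in> B" if g: "g \<in> carrier \<Lambda>" for g
    proof -
      have "\<phi> (g \<otimes>\<^bsub>\<Lambda>\<^esub> inv\<^bsub>\<Lambda>\<^esub> h) (\<phi> h \<omega>) = \<phi> (g \<otimes>\<^bsub>\<Lambda>\<^esub> inv\<^bsub>\<Lambda>\<^esub> h \<otimes>\<^bsub>\<Lambda>\<^esub> h) \<omega>"
        using g h \<omega>(1) by (subst composition_rule) auto
      also have "g \<otimes>\<^bsub>\<Lambda>\<^esub> inv\<^bsub>\<Lambda>\<^esub> h \<otimes>\<^bsub>\<Lambda>\<^esub> h = g" using g h by (simp add: m_assoc)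
      finally show ?thesis using \<omega>(2)[of "g \<otimes>\<^bsub>\<Lambda>\<^esub> inv\<^bsub>\<Lambda>\<^esub> h"] g h by simp
    qed
    then show "\<omega> \<in> C" using \<omega>(1) by (simp add: C_def)
  next
    fix \<omega> assume "\<omega> \<in> C"
    then have \<omega>: "\<omega> \<in> space M" "\<And>g. g \<in> carrier \<Lambda> \<Longrightarrow> \<phi> g \<omega> \<in> B" by (auto simp: C_def)
    have "\<phi> g (\<phi> h \<omega>) \<in> B" if "g \<in> carrier \<Lambda>" for g
      using composition_rule[OF \<omega>(1) that h] \<omega>(2)[of "g \<otimes>\<^bsub>\<Lambda>\<^esub> h"] that h by simp
    then show "\<omega> \<in> \<phi> h -` C \<inter> space M" using \<omega>(1) h sp by (simp add: C_def)
  qed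
  then have "measure M C \<in> {0, 1}" using erg C unfolding ergodic_action_def by blast
  moreover have "measure M C = measure M B"
  proof (rule measure_eq_AE[OF _ C B])
    have "AE \<omega> in M. \<omega> \<notin> displacement M (\<phi> g) B" if "g \<in> carrier \<Lambda>" for g
      using inv[OF that] displacement_sets[OF meas[OF that] B]
      by (intro AE_not_in) (simp add: null_sets_def emeasure_eq_measure)
    then have "AE \<omega> in M. \<forall>g\<in>carrier \<Lambda>. \<omega> \<notin> displacement M (\<phi> g) B"
      using count by (simp add: AE_ball_countable)
    then show "AE \<omega> in M. \<omega> \<in> C \<longleftrightarrow> \<omega> \<in> B"
      using AE_space
    proof eventually_elim
      case (elim \<omega>)
      moreover have "\<phi> \<one>\<^bsub>\<Lambda>\<^esub> \<omega> = \<omega>" using elim(2) by (simp flip: id_eq_one)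
      ultimately show ?case using one_closed unfolding C_def displacement_def by fastforce
    qed
  qed
  ultimately show ?thesis by simp
qed

text \<open>
  A limit in measure of asymptotically invariant sets is invariant up to null sets, hence trivial by
  ergodicity. So asymptotically invariant sets whose measures stay away from 0 and 1 have no
  subsequence converging in measure.
\<close>

lemma measure_limit_of_asymptotically_invariant:
  assumes erg: "ergodic_action \<Lambda> M \<phi>" and count: "countable (carrier \<Lambda>)"
    and A: "asymptotically_invariant \<Lambda> M \<phi> A" and B: "B \<in> sets M"
    and lim: "(\<lambda>n. measure M (sym_diff (A n) B)) \<longlonglongrightarrow> 0"
  shows "(\<lambda>n. measure M (A n) * (1 - measure M (A n))) \<longlonglongrightarrow> 0"
proof -
  have act: "pmp_action \<Lambda> M \<phi>" using erg by (simp add: ergodic_action_def)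
  interpret prob_space M using act by (simp add: pmp_action_def)
  have An: "A n \<in> sets M" for n using A by (simp add: asymptotically_invariant_def)
  have "measure M (displacement M (\<phi> g) B) = 0" if "g \<in> carrier \<Lambda>" for g
  proof -
    have [measurable]: "\<phi> g \<in> measurable M M" and pres: "distr M M (\<phi> g) = M"
      using act that by (auto simp: pmp_action_def)
    note [measurable] = An B
    have "measure M (displacement M (\<phi> g) B) \<le> measure M (sym_diff (A n) B)
        + measure M (displacement M (\<phi> g) (A n)) + measure M (sym_diff (A n) B)" for n
    proof -
      let ?E = "sym_diff (A n) B"
      have "displacement M (\<phi> g) B \<subseteq> ?E \<union> displacement M (\<phi> g) (A n) \<union> (\<phi> g -` ?E \<inter> space M)"
        by (auto simp: displacement_def)
      then have "measure M (displacement M (\<phi> g) B)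
          \<le> measure M (?E \<union> displacement M (\<phi> g) (A n) \<union> (\<phi> g -` ?E \<inter> space M))"
        by (intro finite_measure_mono) measurable
      also have "\<dots> \<le> measure M (?E \<union> displacement M (\<phi> g) (A n)) + measure M (\<phi> g -` ?E \<inter> space M)"
        by (intro measure_Un_le) measurable
      also have "measure M (\<phi> g -` ?E \<inter> space M) = measure M ?E"
        by (intro measure_preserving_vimage pres) measurable
      also have "measure M (?E \<union> displacement M (\<phi> g) (A n))
          \<le> measure M ?E + measure M (displacement M (\<phi> g) (A n))"
        by (intro measure_Un_le) measurable
      finally show ?thesis by simp
    qed
    moreover have "(\<lambda>n. measure M (sym_diff (A n) B) + measure M (displacement M (\<phi> g) (A n))
        + measure M (sym_diff (A n) B)) \<longlonglongrightarrow> 0"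
      using A that
      by (intro tendsto_add_zero lim) (simp add: asymptotically_invariant_iff_displacement)
    ultimately have "measure M (displacement M (\<phi> g) B) \<le> 0"
      by (intro LIMSEQ_le_const) auto
    then show ?thesis by (simp add: measure_le_0_iff)
  qed
  then have "measure M B \<in> {0, 1}" by (rule ergodic_almost_invariant_trivial[OF erg count B])
  moreover have "(\<lambda>n. measure M (A n)) \<longlonglongrightarrow> measure M B"
  proof (rule LIM_zero_cancel, rule tendsto_rabs_zero_cancel, rule tendsto_sandwich[OF _ _ tendsto_const lim])
    have "\<bar>measure M (A n) - measure M B\<bar> \<le> measure M (sym_diff (A n) B)" for n
    proof -
      have le: "measure M U \<le> measure M V + measure M (sym_diff U V)"
        if [measurable]: "U \<in> sets M" "V \<in> sets M" for U V
      proof -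
        have "measure M U \<le> measure M (V \<union> sym_diff U V)" by (intro finite_measure_mono) auto
        also have "\<dots> \<le> measure M V + measure M (sym_diff U V)" by (intro measure_Un_le) auto
        finally show ?thesis .
      qed
      show ?thesis using le[OF An[of n] B] le[OF B An[of n]] by (simp add: Un_commute)
    qed
    then show "\<forall>\<^sub>F n in sequentially. \<bar>measure M (A n) - measure M B\<bar> \<le> measure M (sym_diff (A n) B)"
      by simp
  qed simp
  then have "(\<lambda>n. measure M (A n) * (1 - measure M (A n))) \<longlonglongrightarrow> measure M B * (1 - measure M B)"
    by (intro tendsto_intros)
  ultimately show ?thesis by auto
qed

section \<open>Relative compactness in a metric space\<close>

text \<open>
  The range together with \<open>F\<close> is compact: in an open cover, finitely many members contain \<open>F\<close>, and
  with it all but finitely many terms of the sequence.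
\<close>

lemma (in Metric_space) relatively_compact_near_finite:
  assumes F: "finite F" "F \<subseteq> M" and x: "\<And>n. x n \<in> M" and c: "\<And>n. c n \<in> F"
    and lim: "(\<lambda>n. d (x n) (c n)) \<longlonglongrightarrow> 0"
  shows "relatively_compact_in mtopology (range x)"
proof -
  let ?K = "F \<union> range x"
  have K: "compactin mtopology ?K"
    unfolding compactin_def
  proof (intro conjI allI impI)
    show "?K \<subseteq> topspace mtopology" using F x by auto
  next
    fix \<U> assume \<U>: "(\<forall>U\<in>\<U>. openin mtopology U) \<and> ?K \<subseteq> \<Union>\<U>"
    have "\<forall>y\<in>?K. \<exists>U\<in>\<U>. y \<in> U" using \<U> by blast
    then obtain U where U: "\<And>y. y \<in> ?K \<Longrightarrow> U y \<in> \<U> \<and> y \<in> U y" by metis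
    have "\<forall>\<^sub>F n in sequentially. c n = a \<longrightarrow> x n \<in> U a" if a: "a \<in> F" for a
    proof -
      obtain e where e: "e > 0" "mball a e \<subseteq> U a"
        using \<U> U[of a] a unfolding openin_mtopology by (meson UnI1)
      have "\<forall>\<^sub>F n in sequentially. d (x n) (c n) < e" using order_tendstoD(2)[OF lim e(1)] .
      then show ?thesis
      proof eventually_elim
        case (elim n)
        then show ?case using e(2) x[of n] F a by (auto simp: mball_def commute)
      qed
    qed
    then have "\<forall>\<^sub>F n in sequentially. \<forall>a\<in>F. c n = a \<longrightarrow> x n \<in> U a"
      by (intro eventually_ball_finite F(1) ballI)
    then obtain N where N: "\<And>n. n \<ge> N \<Longrightarrow> x n \<in> U (c n)"
      using c by (auto simp: eventually_sequentially)
    let ?\<F> = "U ` (F \<union> x ` {..<N})"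
    have "?K \<subseteq> \<Union>?\<F>"
    proof
      fix y assume y: "y \<in> ?K"
      show "y \<in> \<Union>?\<F>"
      proof (cases "y \<in> F")
        case False
        then obtain n where n: "y = x n" using y by blast
        show ?thesis
        proof (cases "n < N")
          case True
          then show ?thesis using U[OF y] n by blast
        next
          case False
          then show ?thesis using N[of n] c[of n] n by auto
        qed
      qed (use U[OF y] in blast)
    qed
    moreover have "finite ?\<F>" "?\<F> \<subseteq> \<U>" using F U by auto
    ultimately show "\<exists>\<F>. finite \<F> \<and> \<F> \<subseteq> \<U> \<and> ?K \<subseteq> \<Union>\<F>" by blast
  qed
  have "mtopology closure_of range x \<subseteq> ?K"
    by (intro closure_of_minimal compactin_imp_closedin Hausdorff_space_mtopology K) auto
  then have "compactin mtopology (mtopology closure_of range x)"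
    by (rule closed_compactin[OF K]) simp
  then show ?thesis using x by (auto simp: relatively_compact_in_def)
qed

lemma (in Metric_space) relatively_compact_convergent_subsequence:
  fixes x :: "nat \<Rightarrow> 'a"
  assumes "relatively_compact_in mtopology (range x)"
  shows "\<exists>k l. strict_mono k \<and> limitin mtopology (\<lambda>n. x (k n)) l sequentially"
proof -
  have "range x \<subseteq> mtopology closure_of range x"
    using assms by (intro closure_of_subset) (simp add: relatively_compact_in_def)
  then obtain l k where "strict_mono (k :: nat \<Rightarrow> nat)" "limitin mtopology (x \<circ> k) l sequentially"
    using assms unfolding relatively_compact_in_def compactin_sequentially by blast
  then show ?thesis by (auto simp: o_def)
qed

section \<open>Branch pastings in the space of p-integrable maps\<close>

lemma branch_paste_measurable [measurable]:
  assumes [measurable]: "\<xi>\<^sub>0 \<in> borel_measurable M" "\<xi>\<^sub>1 \<in> borel_measurable M" "A \<in> sets M"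
  shows "branch_paste \<xi>\<^sub>0 \<xi>\<^sub>1 A \<in> borel_measurable M"
  unfolding branch_paste_def by measurable

lemma branch_paste_Lp:
  assumes \<xi>: "\<xi>\<^sub>0 \<in> Lp_fun p M x\<^sub>0" "\<xi>\<^sub>1 \<in> Lp_fun p M x\<^sub>0" and A: "A \<in> sets M"
  shows "branch_paste \<xi>\<^sub>0 \<xi>\<^sub>1 A \<in> Lp_fun p M x\<^sub>0"
proof -
  note [measurable] = \<xi>[THEN Lp_fun_measurable] A
  have "integrable M (\<lambda>\<omega>. dist (branch_paste \<xi>\<^sub>0 \<xi>\<^sub>1 A \<omega>) x\<^sub>0 powr p)"
  proof (rule Bochner_Integration.integrable_bound)
    show "integrable M (\<lambda>\<omega>. dist (\<xi>\<^sub>0 \<omega>) x\<^sub>0 powr p + dist (\<xi>\<^sub>1 \<omega>) x\<^sub>0 powr p)"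
      using \<xi> by (simp add: Lp_fun_def)
  qed (measurable, simp add: branch_paste_def)
  then show ?thesis by (simp add: Lp_fun_def strongly_measurable_iff_borel_measurable)
qed

lemma Lp_class_in_space: "u \<in> Lp_fun p M x\<^sub>0 \<Longrightarrow> Lp_class p M x\<^sub>0 u \<in> Lp_space p M x\<^sub>0"
  by (simp add: Lp_class_def Lp_space_def quotientI)

lemma Lp_space_obtain_representative:
  assumes "U \<in> Lp_space p M x\<^sub>0"
  obtains u where "u \<in> Lp_fun p M x\<^sub>0" "U = Lp_class p M x\<^sub>0 u"
  using assms by (auto simp: Lp_space_def Lp_class_def quotient_def)

lemma tendsto_0_powr_iff:
  fixes f :: "'a \<Rightarrow> real"
  assumes "0 < e" "\<And>x. 0 \<le> f x"
  shows "((\<lambda>x. f x powr e) \<longlongrightarrow> 0) F \<longleftrightarrow> (f \<longlongrightarrow> 0) F"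
proof
  assume "((\<lambda>x. f x powr e) \<longlongrightarrow> 0) F"
  then have "((\<lambda>x. (f x powr e) powr (1 / e)) \<longlongrightarrow> 0) F"
    by (rule tendsto_zero_powrI[OF _ tendsto_const]) (use assms in auto)
  then show "(f \<longlongrightarrow> 0) F" using assms by (simp add: powr_powr)
qed (use assms in \<open>auto intro: tendsto_zero_powrI[OF _ tendsto_const]\<close>)

lemma Lp_dist_fun_tendsto_0_iff:
  assumes "1 \<le> p"
  shows "(\<lambda>n. Lp_dist_fun p M (u n) (v n)) \<longlonglongrightarrow> 0
    \<longleftrightarrow> (\<lambda>n. \<integral>\<omega>. dist (u n \<omega>) (v n \<omega>) powr p \<partial>M) \<longlonglongrightarrow> 0"
  unfolding Lp_dist_fun_def using assms by (intro tendsto_0_powr_iff) auto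

text \<open>
  A set of measure close to 0 or 1 gives a pasting close to \<open>\<xi>\<^sub>0\<close> or \<open>\<xi>\<^sub>1\<close> respectively, so the
  sequence approaches a two-point set.
\<close>

lemma branch_pastings_relatively_compact:
  assumes M: "prob_space M" and p: "1 \<le> p"
    and \<xi>: "\<xi>\<^sub>0 \<in> Lp_fun p M x\<^sub>0" "\<xi>\<^sub>1 \<in> Lp_fun p M x\<^sub>0" and A: "\<And>n. A n \<in> sets M"
    and triv: "(\<lambda>n. measure M (A n) * (1 - measure M (A n))) \<longlonglongrightarrow> 0"
  shows "relatively_compact_in (Lp_topology p M x\<^sub>0)
    (range (\<lambda>n. Lp_class p M x\<^sub>0 (branch_paste \<xi>\<^sub>0 \<xi>\<^sub>1 (A n))))"
proof -
  interpret prob_space M by (rule M)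
  interpret L: Metric_space "Lp_space p M x\<^sub>0" "Lp_dist p M" by (rule Metric_space_Lp[OF p])
  \<comment> \<open>\<open>c n\<close> is the branch used on at least half of the space, and \<open>B n\<close> the set where the other one is used.\<close>
  define small where "small n \<longleftrightarrow> measure M (A n) \<le> 1 / 2" for n
  define B where "B n = (if small n then A n else space M - A n)" for n
  define c where "c n = (if small n then \<xi>\<^sub>0 else \<xi>\<^sub>1)" for n
  have B: "B n \<in> sets M" for n using A by (simp add: B_def)
  have small_B: "measure M (B n) \<le> 2 * (measure M (A n) * (1 - measure M (A n)))" for n
  proof (cases "small n")
    case True
    then show ?thesis
      using mult_left_mono[of "1 / 2" "1 - measure M (A n)" "measure M (A n)"]
      by (simp add: B_def small_def)
  next
    case False
    then show ?thesis
      using mult_right_mono[of "1 / 2" "measure M (A n)" "1 - measure M (A n)"] A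
      by (simp add: B_def small_def prob_compl)
  qed
  have muB: "(\<lambda>n. measure M (B n)) \<longlonglongrightarrow> 0"
  proof (rule tendsto_sandwich[OF _ _ tendsto_const tendsto_mult_right_zero[OF triv, where c = 2]])
    show "\<forall>\<^sub>F n in sequentially. measure M (B n) \<le> 2 * (measure M (A n) * (1 - measure M (A n)))"
      by (intro always_eventually allI small_B)
  qed simp
  let ?h = "\<lambda>\<omega>. dist (\<xi>\<^sub>0 \<omega>) (\<xi>\<^sub>1 \<omega>) powr p"
  have "(\<lambda>n. \<integral>\<omega>. ?h \<omega> * indicator (B n) \<omega> \<partial>M) \<longlonglongrightarrow> 0"
    by (rule integral_tendsto_0_if_measure[OF finite_measure_axioms Lp_dist_integrable[OF p \<xi>] _ B muB])
       simp
  moreover have "(\<integral>\<omega>. ?h \<omega> * indicator (B n) \<omega> \<partial>M)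
      = (\<integral>\<omega>. dist (branch_paste \<xi>\<^sub>0 \<xi>\<^sub>1 (A n) \<omega>) (c n \<omega>) powr p \<partial>M)" for n
    by (intro Bochner_Integration.integral_cong)
       (auto simp: B_def c_def branch_paste_def dist_commute)
  ultimately have "(\<lambda>n. Lp_dist_fun p M (branch_paste \<xi>\<^sub>0 \<xi>\<^sub>1 (A n)) (c n)) \<longlonglongrightarrow> 0"
    by (simp add: Lp_dist_fun_tendsto_0_iff[OF p])
  moreover have cLp: "c n \<in> Lp_fun p M x\<^sub>0" for n using \<xi> by (simp add: c_def)
  ultimately have "(\<lambda>n. Lp_dist p M (Lp_class p M x\<^sub>0 (branch_paste \<xi>\<^sub>0 \<xi>\<^sub>1 (A n)))
      (Lp_class p M x\<^sub>0 (c n))) \<longlonglongrightarrow> 0"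
    by (simp add: Lp_dist_class branch_paste_Lp \<xi> A)
  then show ?thesis
    unfolding Lp_topology_def
    using \<xi> A by (intro L.relatively_compact_near_finite[where
          F = "{Lp_class p M x\<^sub>0 \<xi>\<^sub>0, Lp_class p M x\<^sub>0 \<xi>\<^sub>1}" and c = "\<lambda>n. Lp_class p M x\<^sub>0 (c n)"])
      (auto intro: Lp_class_in_space branch_paste_Lp simp: c_def)
qed

text \<open>
  The set \<open>A\<close> can be recovered from its pasting as the set where the pasting equals \<open>\<xi>\<^sub>1\<close>, because the
  branches are almost nowhere equal. The same recipe applied to a limit \<open>u\<close> gives \<open>B\<close>.
\<close>

lemma branch_pastings_limit_set:
  assumes M: "prob_space M" and p: "1 \<le> p"
    and \<xi>: "\<xi>\<^sub>0 \<in> Lp_fun p M x\<^sub>0" "\<xi>\<^sub>1 \<in> Lp_fun p M x\<^sub>0" and sep: "AE \<omega> in M. dist (\<xi>\<^sub>0 \<omega>) (\<xi>\<^sub>1 \<omega>) > 0"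
    and A: "\<And>n. A n \<in> sets M"
    and lim: "limitin (Lp_topology p M x\<^sub>0)
      (\<lambda>n. Lp_class p M x\<^sub>0 (branch_paste \<xi>\<^sub>0 \<xi>\<^sub>1 (A n))) U sequentially"
  obtains B where "B \<in> sets M" "(\<lambda>n. measure M (sym_diff (A n) B)) \<longlonglongrightarrow> 0"
proof -
  interpret prob_space M by (rule M)
  interpret L: Metric_space "Lp_space p M x\<^sub>0" "Lp_dist p M" by (rule Metric_space_Lp[OF p])
  let ?\<Gamma> = "\<lambda>n. branch_paste \<xi>\<^sub>0 \<xi>\<^sub>1 (A n)"
  have U: "U \<in> Lp_space p M x\<^sub>0"
    and dist0: "(\<lambda>n. Lp_dist p M (Lp_class p M x\<^sub>0 (?\<Gamma> n)) U) \<longlonglongrightarrow> 0"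
    using lim by (auto simp: Lp_topology_def L.limitin_metric_dist_null)
  from U obtain u where u: "u \<in> Lp_fun p M x\<^sub>0" "U = Lp_class p M x\<^sub>0 u"
    by (rule Lp_space_obtain_representative)
  note [measurable] = \<xi>[THEN Lp_fun_measurable] u(1)[THEN Lp_fun_measurable] A
  have \<Gamma>: "?\<Gamma> n \<in> Lp_fun p M x\<^sub>0" for n using \<xi> A by (rule branch_paste_Lp)
  have dist1: "(\<lambda>n. \<integral>\<omega>. dist (?\<Gamma> n \<omega>) (u \<omega>) powr p \<partial>M) \<longlonglongrightarrow> 0"
    using dist0 by (simp add: u Lp_dist_class \<Gamma> Lp_dist_fun_tendsto_0_iff[OF p])
  define B where "B = {\<omega> \<in> space M. dist (u \<omega>) (\<xi>\<^sub>1 \<omega>) = 0}"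
  have B [measurable]: "B \<in> sets M" unfolding B_def by measurable
  \<comment> \<open>On \<open>B - A n\<close> the pasting is \<open>\<xi>\<^sub>0\<close> and \<open>u\<close> is \<open>\<xi>\<^sub>1\<close>; on \<open>A n - B\<close> the pasting is \<open>\<xi>\<^sub>1\<close>, which
      differs from \<open>u\<close>. So on \<open>sym_diff (A n) B\<close> the distance to \<open>u\<close> does not depend on \<open>n\<close>: its
      power is \<open>h\<close>, which is positive almost everywhere.\<close>
  define h where "h \<omega> = (if \<omega> \<in> B then dist (\<xi>\<^sub>0 \<omega>) (\<xi>\<^sub>1 \<omega>) else dist (\<xi>\<^sub>1 \<omega>) (u \<omega>)) powr p" for \<omega>
  have [measurable]: "h \<in> borel_measurable M" unfolding h_def by measurable
  have h: "integrable M h"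
  proof (rule Bochner_Integration.integrable_bound)
    show "integrable M (\<lambda>\<omega>. dist (\<xi>\<^sub>0 \<omega>) (\<xi>\<^sub>1 \<omega>) powr p + dist (\<xi>\<^sub>1 \<omega>) (u \<omega>) powr p)"
      using p \<xi> u by (intro Bochner_Integration.integrable_add Lp_dist_integrable) auto
  qed (measurable, simp add: h_def)
  have hpos: "AE \<omega> in M. 0 < h \<omega>"
    using sep AE_space by eventually_elim (auto simp: h_def B_def dist_commute)
  have bound: "(\<integral>\<omega>. h \<omega> * indicator (sym_diff (A n) B) \<omega> \<partial>M)
      \<le> (\<integral>\<omega>. dist (?\<Gamma> n \<omega>) (u \<omega>) powr p \<partial>M)" for n
  proof (rule integral_mono)
    have D: "sym_diff (A n) B \<in> sets M" by measurable
    show "integrable M (\<lambda>\<omega>. h \<omega> * indicator (sym_diff (A n) B) \<omega>)"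
      using integrable_mult_indicator[OF D h] by (simp add: mult.commute)
    show "integrable M (\<lambda>\<omega>. dist (?\<Gamma> n \<omega>) (u \<omega>) powr p)"
      using Lp_dist_integrable[OF p \<Gamma> u(1)] .
    fix \<omega> assume "\<omega> \<in> space M"
    then show "h \<omega> * indicator (sym_diff (A n) B) \<omega> \<le> dist (?\<Gamma> n \<omega>) (u \<omega>) powr p"
      by (auto simp: h_def B_def branch_paste_def dist_commute indicator_def)
  qed
  have "(\<lambda>n. \<integral>\<omega>. h \<omega> * indicator (sym_diff (A n) B) \<omega> \<partial>M) \<longlonglongrightarrow> 0"
    by (rule tendsto_sandwich[OF _ _ tendsto_const dist1])
       (use bound in \<open>auto intro!: always_eventually integral_nonneg_AE simp: h_def\<close>)
  then have "(\<lambda>n. measure M (sym_diff (A n) B)) \<longlonglongrightarrow> 0"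
    by (intro measure_tendsto_0_if_integral[OF finite_measure_axioms h _ hpos]) (auto simp: h_def)
  then show ?thesis using that B by blast
qed

section \<open>Residuals of branch pastings\<close>

text \<open>
  Off the displacement both endpoints of the step use the same branch, and the residual vanishes
  almost everywhere; on it the two endpoints use different branches. Hence the residual integral is squeezed between the
  integrals of the minimal and the maximal cross-branch residual over the displacement.
\<close>

lemma one_step_residual_tendsto_0_iff:
  fixes H :: "'w \<Rightarrow> 'x::polish_space \<Rightarrow> 'x \<Rightarrow> 'y::real_normed_vector"
  assumes M: "prob_space M" and p: "1 \<le> p" and T: "T \<in> measurable M M"
    and H: "(\<lambda>(\<omega>, x, y). H \<omega> x y) \<in> borel_measurable (M \<Otimes>\<^sub>M (borel \<Otimes>\<^sub>M borel))"
    and \<xi>: "\<xi>\<^sub>0 \<in> borel_measurable M" "\<xi>\<^sub>1 \<in> borel_measurable M"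
    and zero: "AE \<omega> in M. H \<omega> (\<xi>\<^sub>0 \<omega>) (\<xi>\<^sub>0 (T \<omega>)) = 0" "AE \<omega> in M. H \<omega> (\<xi>\<^sub>1 \<omega>) (\<xi>\<^sub>1 (T \<omega>)) = 0"
    and q: "integrable M (\<lambda>\<omega>. max (norm (H \<omega> (\<xi>\<^sub>0 \<omega>) (\<xi>\<^sub>1 (T \<omega>)))) (norm (H \<omega> (\<xi>\<^sub>1 \<omega>) (\<xi>\<^sub>0 (T \<omega>)))) powr p)"
    and r: "AE \<omega> in M. min (norm (H \<omega> (\<xi>\<^sub>0 \<omega>) (\<xi>\<^sub>1 (T \<omega>)))) (norm (H \<omega> (\<xi>\<^sub>1 \<omega>) (\<xi>\<^sub>0 (T \<omega>)))) > 0"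
    and A: "\<And>n. A n \<in> sets M"
  shows "(\<lambda>n. \<integral>\<omega>. norm (H \<omega> (branch_paste \<xi>\<^sub>0 \<xi>\<^sub>1 (A n) \<omega>) (branch_paste \<xi>\<^sub>0 \<xi>\<^sub>1 (A n) (T \<omega>))) powr p \<partial>M)
      \<longlonglongrightarrow> 0 \<longleftrightarrow> (\<lambda>n. measure M (displacement M T (A n))) \<longlonglongrightarrow> 0"
proof -
  interpret prob_space M by (rule M)
  note [measurable] = T \<xi> A
  define Q where "Q \<omega> = max (norm (H \<omega> (\<xi>\<^sub>0 \<omega>) (\<xi>\<^sub>1 (T \<omega>)))) (norm (H \<omega> (\<xi>\<^sub>1 \<omega>) (\<xi>\<^sub>0 (T \<omega>)))) powr p" for \<omega>
  define R where "R \<omega> = min (norm (H \<omega> (\<xi>\<^sub>0 \<omega>) (\<xi>\<^sub>1 (T \<omega>)))) (norm (H \<omega> (\<xi>\<^sub>1 \<omega>) (\<xi>\<^sub>0 (T \<omega>)))) powr p" for \<omega>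
  define F where "F n \<omega> = norm (H \<omega> (branch_paste \<xi>\<^sub>0 \<xi>\<^sub>1 (A n) \<omega>) (branch_paste \<xi>\<^sub>0 \<xi>\<^sub>1 (A n) (T \<omega>))) powr p" for n \<omega>
  let ?D = "\<lambda>n. displacement M T (A n)"
  have D: "?D n \<in> sets M" for n by measurable
  have meas: "(\<lambda>\<omega>. norm (H \<omega> (u \<omega>) (v (T \<omega>)))) \<in> borel_measurable M"
    if [measurable]: "u \<in> borel_measurable M" "v \<in> borel_measurable M" for u v
  proof -
    have "(\<lambda>\<omega>. (\<omega>, u \<omega>, v (T \<omega>))) \<in> measurable M (M \<Otimes>\<^sub>M (borel \<Otimes>\<^sub>M borel))" by measurable
    from measurable_comp[OF this H] have "(\<lambda>\<omega>. H \<omega> (u \<omega>) (v (T \<omega>))) \<in> borel_measurable M"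
      by (simp add: o_def)
    then show ?thesis
      by (rule borel_measurable_continuous_on[OF continuous_on_norm_id])
  qed
  note [measurable] = meas[OF \<xi>] meas[OF \<xi>(2,1)]
  have Q: "integrable M Q" using q by (simp add: Q_def[abs_def])
  have Q0: "0 \<le> Q \<omega>" and R0: "0 \<le> R \<omega>" and F0: "0 \<le> F n \<omega>" for n \<omega>
    by (simp_all add: Q_def R_def F_def)
  have Rm: "R \<in> borel_measurable M" unfolding R_def[abs_def] by measurable
  have Fm: "F n \<in> borel_measurable M" for n
  proof -
    have [measurable]: "(\<lambda>\<omega>. norm (H \<omega> (branch_paste \<xi>\<^sub>0 \<xi>\<^sub>1 (A n) \<omega>) (branch_paste \<xi>\<^sub>0 \<xi>\<^sub>1 (A n) (T \<omega>))))
        \<in> borel_measurable M"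
      by (intro meas) measurable
    show ?thesis unfolding F_def[abs_def] by measurable
  qed
  have "R \<omega> \<le> Q \<omega>" for \<omega> using p by (auto simp: R_def Q_def intro!: powr_mono2)
  then have R: "integrable M R"
    using Q0 R0 by (intro Bochner_Integration.integrable_bound[OF Q Rm]) simp
  have Rpos: "AE \<omega> in M. 0 < R \<omega>" using r by eventually_elim (auto simp: R_def min_def split: if_splits)
  have FQ: "AE \<omega> in M. F n \<omega> \<le> Q \<omega> * indicator (?D n) \<omega>"
    and RF: "AE \<omega> in M. R \<omega> * indicator (?D n) \<omega> \<le> F n \<omega>" for n
  proof -
    have "AE \<omega> in M. R \<omega> * indicator (?D n) \<omega> \<le> F n \<omega> \<and> F n \<omega> \<le> Q \<omega> * indicator (?D n) \<omega>"
      using zero AE_space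
    proof eventually_elim
      case (elim \<omega>)
      then have "\<omega> \<in> ?D n \<longleftrightarrow> (\<omega> \<in> A n) \<noteq> (T \<omega> \<in> A n)" by (auto simp: displacement_def)
      then show ?case
        using elim p
        by (cases "\<omega> \<in> A n"; cases "T \<omega> \<in> A n")
           (auto simp: F_def Q_def R_def branch_paste_def intro!: powr_mono2)
    qed
    then show "AE \<omega> in M. F n \<omega> \<le> Q \<omega> * indicator (?D n) \<omega>"
      "AE \<omega> in M. R \<omega> * indicator (?D n) \<omega> \<le> F n \<omega>" by auto
  qed
  have QD: "integrable M (\<lambda>\<omega>. Q \<omega> * indicator (?D n) \<omega>)"
    and RD: "integrable M (\<lambda>\<omega>. R \<omega> * indicator (?D n) \<omega>)" for n
    using integrable_mult_indicator[OF D Q] integrable_mult_indicator[OF D R]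
    by (simp_all add: mult.commute)
  have F: "integrable M (F n)" for n
    using FQ[of n] by (intro Bochner_Integration.integrable_bound[OF QD[of n] Fm])
       (auto simp: F0 Q0 elim: eventually_mono)
  have upper: "(\<integral>\<omega>. F n \<omega> \<partial>M) \<le> (\<integral>\<omega>. Q \<omega> * indicator (?D n) \<omega> \<partial>M)"
    and lower: "(\<integral>\<omega>. R \<omega> * indicator (?D n) \<omega> \<partial>M) \<le> (\<integral>\<omega>. F n \<omega> \<partial>M)" for n
    by (intro integral_mono_AE F QD RD FQ RF)+
  have "(\<lambda>n. \<integral>\<omega>. F n \<omega> \<partial>M) \<longlonglongrightarrow> 0 \<longleftrightarrow> (\<lambda>n. measure M (?D n)) \<longlonglongrightarrow> 0"
  proof
    assume "(\<lambda>n. \<integral>\<omega>. F n \<omega> \<partial>M) \<longlonglongrightarrow> 0"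
    then have "(\<lambda>n. \<integral>\<omega>. R \<omega> * indicator (?D n) \<omega> \<partial>M) \<longlonglongrightarrow> 0"
      by (rule tendsto_sandwich[OF _ _ tendsto_const, rotated 2])
         (use lower R0 in \<open>auto intro!: always_eventually integral_nonneg_AE\<close>)
    then show "(\<lambda>n. measure M (?D n)) \<longlonglongrightarrow> 0"
      by (rule measure_tendsto_0_if_integral[OF finite_measure_axioms R R0 Rpos D])
  next
    assume L: "(\<lambda>n. measure M (?D n)) \<longlonglongrightarrow> 0"
    have "(\<lambda>n. \<integral>\<omega>. Q \<omega> * indicator (?D n) \<omega> \<partial>M) \<longlonglongrightarrow> 0"
      by (rule integral_tendsto_0_if_measure[OF finite_measure_axioms Q Q0 D L])
    then show "(\<lambda>n. \<integral>\<omega>. F n \<omega> \<partial>M) \<longlonglongrightarrow> 0"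
      by (rule tendsto_sandwich[OF _ _ tendsto_const, rotated 2])
         (use upper F0 in \<open>auto intro!: always_eventually integral_nonneg_AE\<close>)
  qed
  then show ?thesis by (simp add: F_def)
qed

lemma residual_norm_tendsto_0_iff:
  assumes "finite S" "1 \<le> p"
  shows "(\<lambda>n. residual_norm p M \<phi> S G (\<Gamma> n)) \<longlonglongrightarrow> 0 \<longleftrightarrow>
    (\<forall>s\<in>S. (\<lambda>n. \<integral>\<omega>. norm (G s \<omega> (\<Gamma> n \<omega>) (\<Gamma> n (\<phi> s \<omega>))) powr p \<partial>M) \<longlonglongrightarrow> 0)"
proof -
  let ?I = "\<lambda>n s. \<integral>\<omega>. norm (G s \<omega> (\<Gamma> n \<omega>) (\<Gamma> n (\<phi> s \<omega>))) powr p \<partial>M"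
  have nn: "0 \<le> ?I n s" for n s by simp
  have "(\<lambda>n. residual_norm p M \<phi> S G (\<Gamma> n)) \<longlonglongrightarrow> 0 \<longleftrightarrow> (\<lambda>n. \<Sum>s\<in>S. ?I n s) \<longlonglongrightarrow> 0"
    unfolding residual_norm_def using assms by (intro tendsto_0_powr_iff) (auto intro: sum_nonneg)
  also have "\<dots> \<longleftrightarrow> (\<forall>s\<in>S. (\<lambda>n. ?I n s) \<longlonglongrightarrow> 0)"
  proof
    assume L: "(\<lambda>n. \<Sum>s\<in>S. ?I n s) \<longlonglongrightarrow> 0"
    have "?I n s \<le> (\<Sum>s\<in>S. ?I n s)" if "s \<in> S" for n s
      using that assms nn by (intro member_le_sum)
    then show "\<forall>s\<in>S. (\<lambda>n. ?I n s) \<longlonglongrightarrow> 0"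
      by (intro ballI tendsto_sandwich[OF _ _ tendsto_const L]) auto
  qed (auto intro: tendsto_null_sum)
  finally show ?thesis .
qed

section \<open>Strong ergodicity and compactness of pasting sequences\<close>

theorem corollary8p4:
  fixes M :: "'w measure"
    and \<Lambda> :: "('g, 'b) monoid_scheme"
    and \<phi> :: "'g \<Rightarrow> 'w \<Rightarrow> 'w"
    and S :: "'g set"
    and p :: real
    and x\<^sub>0 :: "'x::polish_space"
    and Y :: "'g \<Rightarrow> 'y::banach set"
    and G :: "'g \<Rightarrow> 'w \<Rightarrow> 'x \<Rightarrow> 'x \<Rightarrow> 'y"
    and \<xi>\<^sub>0 \<xi>\<^sub>1 :: "'w \<Rightarrow> 'x"
  defines "q \<equiv> \<lambda>s \<omega>. max (norm (G s \<omega> (\<xi>\<^sub>0 \<omega>) (\<xi>\<^sub>1 (\<phi> s \<omega>)))) (norm (G s \<omega> (\<xi>\<^sub>1 \<omega>) (\<xi>\<^sub>0 (\<phi> s \<omega>))))"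
    and "r \<equiv> \<lambda>s \<omega>. min (norm (G s \<omega> (\<xi>\<^sub>0 \<omega>) (\<xi>\<^sub>1 (\<phi> s \<omega>)))) (norm (G s \<omega> (\<xi>\<^sub>1 \<omega>) (\<xi>\<^sub>0 (\<phi> s \<omega>))))"
    and "\<Gamma> \<equiv> branch_paste \<xi>\<^sub>0 \<xi>\<^sub>1"
  assumes "standard_prob_space M"
    and "group \<Lambda>" "finite S" "S \<subseteq> carrier \<Lambda>" "set_inv\<^bsub>\<Lambda>\<^esub> S = S" "generate \<Lambda> S = carrier \<Lambda>"
    and "ergodic_action \<Lambda> M \<phi>"
    and "1 \<le> p"
    and "\<And>s. s \<in> S \<Longrightarrow> subspace (Y s) \<and> closed (Y s)"
    and "\<And>s \<omega> x y. s \<in> S \<Longrightarrow> \<omega> \<in> space M \<Longrightarrow> G s \<omega> x y \<in> Y s"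
    and "\<And>s. s \<in> S \<Longrightarrow>
          (\<lambda>(\<omega>, x, y). G s \<omega> x y) \<in> borel_measurable (M \<Otimes>\<^sub>M (borel \<Otimes>\<^sub>M borel))"
    and "\<xi>\<^sub>0 \<in> Lp_fun p M x\<^sub>0" "\<xi>\<^sub>1 \<in> Lp_fun p M x\<^sub>0"
    and "AE \<omega> in M. dist (\<xi>\<^sub>0 \<omega>) (\<xi>\<^sub>1 \<omega>) > 0"
    and "\<And>s. s \<in> S \<Longrightarrow> AE \<omega> in M. G s \<omega> (\<xi>\<^sub>0 \<omega>) (\<xi>\<^sub>0 (\<phi> s \<omega>)) = 0"
    and "\<And>s. s \<in> S \<Longrightarrow> AE \<omega> in M. G s \<omega> (\<xi>\<^sub>1 \<omega>) (\<xi>\<^sub>1 (\<phi> s \<omega>)) = 0"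
    and "\<And>s. s \<in> S \<Longrightarrow> integrable M (\<lambda>\<omega>. q s \<omega> powr p)"
    and "\<And>s. s \<in> S \<Longrightarrow> AE \<omega> in M. r s \<omega> > 0"
  shows "(strongly_ergodic \<Lambda> M \<phi> \<longleftrightarrow>
           (\<forall>A :: nat \<Rightarrow> 'w set.
              (\<forall>n. A n \<in> sets M) \<and> (\<lambda>n. residual_norm p M \<phi> S G (\<Gamma> (A n))) \<longlonglongrightarrow> 0 \<longrightarrow>
              relatively_compact_in (Lp_topology p M x\<^sub>0) (range (\<lambda>n. Lp_class p M x\<^sub>0 (\<Gamma> (A n))))))
         \<and> (\<not> strongly_ergodic \<Lambda> M \<phi> \<longrightarrow>
           (\<exists>A :: nat \<Rightarrow> 'w set.
              (\<forall>n. A n \<in> sets M) \<and> (\<lambda>n. residual_norm p M \<phi> S G (\<Gamma> (A n))) \<longlonglongrightarrow> 0 \<and>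
              (\<nexists>k U. strict_mono k \<and>
                 limitin (Lp_topology p M x\<^sub>0) (\<lambda>n. Lp_class p M x\<^sub>0 (\<Gamma> (A (k n)))) U sequentially)))"
    (is "(_ \<longleftrightarrow> ?compact) \<and> (_ \<longrightarrow> ?escape)")
proof -
  note erg = \<open>ergodic_action \<Lambda> M \<phi>\<close> and p = \<open>1 \<le> p\<close>
    and \<xi> = \<open>\<xi>\<^sub>0 \<in> Lp_fun p M x\<^sub>0\<close> \<open>\<xi>\<^sub>1 \<in> Lp_fun p M x\<^sub>0\<close>
    and S = \<open>S \<subseteq> carrier \<Lambda>\<close> \<open>set_inv\<^bsub>\<Lambda>\<^esub> S = S\<close> \<open>generate \<Lambda> S = carrier \<Lambda>\<close>
  have act: "pmp_action \<Lambda> M \<phi>" using erg by (simp add: ergodic_action_def)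
  then have M: "prob_space M" by (simp add: pmp_action_def)
  have count: "countable (carrier \<Lambda>)"
    using countable_generate[OF \<open>group \<Lambda>\<close> countable_finite[OF \<open>finite S\<close>] S(1)] S(3) by simp
  note residual_hyps =
    \<open>\<And>s. s \<in> S \<Longrightarrow> (\<lambda>(\<omega>, x, y). G s \<omega> x y) \<in> borel_measurable (M \<Otimes>\<^sub>M (borel \<Otimes>\<^sub>M borel))\<close>
    \<open>\<And>s. s \<in> S \<Longrightarrow> AE \<omega> in M. G s \<omega> (\<xi>\<^sub>0 \<omega>) (\<xi>\<^sub>0 (\<phi> s \<omega>)) = 0\<close>
    \<open>\<And>s. s \<in> S \<Longrightarrow> AE \<omega> in M. G s \<omega> (\<xi>\<^sub>1 \<omega>) (\<xi>\<^sub>1 (\<phi> s \<omega>)) = 0\<close>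
    \<open>\<And>s. s \<in> S \<Longrightarrow> integrable M (\<lambda>\<omega>. q s \<omega> powr p)\<close>
    \<open>\<And>s. s \<in> S \<Longrightarrow> AE \<omega> in M. r s \<omega> > 0\<close>
  have residual: "(\<lambda>n. residual_norm p M \<phi> S G (\<Gamma> (A n))) \<longlonglongrightarrow> 0 \<longleftrightarrow> asymptotically_invariant \<Lambda> M \<phi> A"
    if A: "\<And>n. A n \<in> sets M" for A
  proof -
    have "(\<lambda>n. \<integral>\<omega>. norm (G s \<omega> (\<Gamma> (A n) \<omega>) (\<Gamma> (A n) (\<phi> s \<omega>))) powr p \<partial>M) \<longlonglongrightarrow> 0
      \<longleftrightarrow> (\<lambda>n. measure M (displacement M (\<phi> s) (A n))) \<longlonglongrightarrow> 0" if s: "s \<in> S" for s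
      unfolding \<Gamma>_def
    proof (rule one_step_residual_tendsto_0_iff[where H = "G s" and T = "\<phi> s", OF M p])
      show "\<phi> s \<in> measurable M M" using act s S(1) by (auto simp: pmp_action_def)
    qed (fact \<xi>[THEN Lp_fun_measurable] A residual_hyps[OF s, unfolded q_def r_def])+
    then show ?thesis
      by (simp add: residual_norm_tendsto_0_iff[OF \<open>finite S\<close> p]
          asymptotically_invariant_iff_generators[OF act S A])
  qed
  have escape: ?escape if not_se: "\<not> strongly_ergodic \<Lambda> M \<phi>"
  proof -
    obtain A where A: "asymptotically_invariant \<Lambda> M \<phi> A"
      and big: "\<not> (\<lambda>n. measure M (A n) * (1 - measure M (A n))) \<longlonglongrightarrow> 0"
      using not_se erg unfolding strongly_ergodic_def by blast
    let ?v = "\<lambda>n. measure M (A n) * (1 - measure M (A n))"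
    obtain e where e: "e > 0" "\<not> (\<forall>\<^sub>F n in sequentially. dist (?v n) 0 < e)"
      using big unfolding tendsto_iff by blast
    then have "infinite {n. e \<le> dist (?v n) 0}"
      by (simp add: eventually_sequentially infinite_nat_iff_unbounded_le not_less)
    then obtain l :: "nat \<Rightarrow> nat" where l: "strict_mono l" "\<And>n. e \<le> dist (?v (l n)) 0"
      using infinite_enumerate by blast
    have sub: "asymptotically_invariant \<Lambda> M \<phi> (\<lambda>n. A (k n))" if "strict_mono k" for k
      using A LIMSEQ_subseq_LIMSEQ[OF _ that] by (auto simp: asymptotically_invariant_def o_def)
    have sets: "A n \<in> sets M" for n using A by (simp add: asymptotically_invariant_def)
    have False if k: "strict_mono k" and lim: "limitin (Lp_topology p M x\<^sub>0)
        (\<lambda>n. Lp_class p M x\<^sub>0 (\<Gamma> (A (l (k n))))) U sequentially" for k U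
    proof -
      obtain B where "B \<in> sets M" "(\<lambda>n. measure M (sym_diff (A (l (k n))) B)) \<longlonglongrightarrow> 0"
        using branch_pastings_limit_set[OF M p \<xi> \<open>AE \<omega> in M. dist (\<xi>\<^sub>0 \<omega>) (\<xi>\<^sub>1 \<omega>) > 0\<close> sets lim[unfolded \<Gamma>_def]] .
      then have "(\<lambda>n. ?v (l (k n))) \<longlonglongrightarrow> 0"
        using sub[OF strict_mono_o[OF l(1) k]]
        by (intro measure_limit_of_asymptotically_invariant[OF erg count]) (auto simp: o_def)
      then have "\<forall>\<^sub>F n in sequentially. dist (?v (l (k n))) 0 < e" using e(1) by (rule tendstoD)
      then obtain n where "dist (?v (l (k n))) 0 < e" using eventually_happens by fastforce
      then show False using l(2)[of "k n"] by simp
    qed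
    then show ?thesis
      using sub[OF l(1)] sets residual[of "\<lambda>n. A (l n)"] by (intro exI[of _ "\<lambda>n. A (l n)"]) blast
  qed
  have "?compact" if "strongly_ergodic \<Lambda> M \<phi>"
    using that branch_pastings_relatively_compact[OF M p \<xi>] residual
    unfolding strongly_ergodic_def \<Gamma>_def by blast
  moreover have "\<not> ?compact" if "\<not> strongly_ergodic \<Lambda> M \<phi>"
  proof
    assume ?compact
    with escape[OF that] show False
      using Metric_space.relatively_compact_convergent_subsequence[OF Metric_space_Lp[OF p, of M x\<^sub>0]]
      unfolding Lp_topology_def by meson
  qed
  ultimately show ?thesis using escape by blast
qed

end
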